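(* Let $A=(A,\cdot,\circ)$ be a bi-skew brace. Then the group $(A,\cdot)$ is soluble if and only if the group $(A,\circ)$ is soluble. Moreover, in this case $A$ is also soluble as a skew brace.
   Context: A skew brace (meaning skew left brace) is a set $A$ with two group structures $(A,\cdot)$ (the additive group) and $(A,\circ)$ (the multiplicative group) such that $a\circ(b\cdot c)=(a\circ b)\cdot a^{-1}\cdot(a\circ c)$ for all $a,b,c\in A$, where $a^{-1}$ is the inverse of $a$ in $(A,\cdot)$. The two groups have the same neutral element, denoted $1$. A bi-skew brace is a skew brace $(A,\cdot,\circ)$ such that $(A,\circ,\cdot)$ is also a skew brace. For $a,b\in A$ put $a*b=a^{-1}\cdot(a\circ b)\cdot b^{-1}$. For subsets $X,Y\subseteq A$, $X*Y$ is the subgroup of $(A,\cdot)$ generated by $\{x*y\mid x\in X,\ y\in Y\}$. Set $A_1=A$ and $A_m=A_{m-1}*A_{m-1}$ for $m\ge 2$. The skew brace $A$ is soluble if $A_m=\{1\}$ for some $m\ge1$. *)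

theory Defs
  imports "HOL-Algebra.Solvable_Groups"
begin

text \<open>
  A skew (left) brace is given by two group records on one carrier: \<open>A\<close> is the additive
  group (written \<open>\<cdot>\<close> in the literature) and \<open>M\<close> the multiplicative group (written \<open>\<circ>\<close>).
  That the two neutral elements agree follows from the axioms.
\<close>

locale skew_brace =
  fixes A :: "('a, 'b) monoid_scheme" and M :: "('a, 'c) monoid_scheme"
  assumes add_group: "group A"
    and mult_group: "group M"
    and carrier_eq: "carrier M = carrier A"
    and compat: "\<lbrakk> a \<in> carrier A; b \<in> carrier A; c \<in> carrier A \<rbrakk> \<Longrightarrow>
      a \<otimes>\<^bsub>M\<^esub> (b \<otimes>\<^bsub>A\<^esub> c) = (a \<otimes>\<^bsub>M\<^esub> b) \<otimes>\<^bsub>A\<^esub> inv\<^bsub>A\<^esub> a \<otimes>\<^bsub>A\<^esub> (a \<otimes>\<^bsub>M\<^esub> c)"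

locale bi_skew_brace =
  skew_brace A M + opposite: skew_brace M A
  for A :: "('a, 'b) monoid_scheme" and M :: "('a, 'c) monoid_scheme"

definition brace_star ::
  "('a, 'b) monoid_scheme \<Rightarrow> ('a, 'c) monoid_scheme \<Rightarrow> 'a \<Rightarrow> 'a \<Rightarrow> 'a"
  where "brace_star A M a b = inv\<^bsub>A\<^esub> a \<otimes>\<^bsub>A\<^esub> (a \<otimes>\<^bsub>M\<^esub> b) \<otimes>\<^bsub>A\<^esub> inv\<^bsub>A\<^esub> b"

definition brace_star_set ::
  "('a, 'b) monoid_scheme \<Rightarrow> ('a, 'c) monoid_scheme \<Rightarrow> 'a set \<Rightarrow> 'a set \<Rightarrow> 'a set"
  where "brace_star_set A M X Y = generate A {brace_star A M x y | x y. x \<in> X \<and> y \<in> Y}"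

text \<open>
  The series starts at index 1: \<open>A\<^sub>1 = A\<close> and \<open>A\<^sub>m = A\<^sub>m\<^sub>-\<^sub>1 * A\<^sub>m\<^sub>-\<^sub>1\<close> for \<open>m \<ge> 2\<close>.
  The value at index 0 has no meaning.
\<close>

definition brace_derived_series ::
  "('a, 'b) monoid_scheme \<Rightarrow> ('a, 'c) monoid_scheme \<Rightarrow> nat \<Rightarrow> 'a set"
  where "brace_derived_series A M m = ((\<lambda>X. brace_star_set A M X X) ^^ (m - 1)) (carrier A)"

definition soluble_brace ::
  "('a, 'b) monoid_scheme \<Rightarrow> ('a, 'c) monoid_scheme \<Rightarrow> bool"
  where "soluble_brace A M \<longleftrightarrow> (\<exists>m\<ge>1. brace_derived_series A M m = {\<one>\<^bsub>A\<^esub>})"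

end

theory Submission
  imports Defs "HOL-Algebra.Bij"
begin

text \<open>
  Write \<open>\<lambda>\<^sub>a b = a\<^sup>-\<^sup>1 \<cdot> (a \<circ> b)\<close>. In every skew brace \<open>a \<mapsto> \<lambda>\<^sub>a\<close> is an action of the multiplicative
  group on the carrier. In a bi-skew brace the opposite brace contributes a second action
  \<open>\<mu>\<^sub>a b = a' \<circ> (a \<cdot> b)\<close>, with \<open>a'\<close> the multiplicative inverse, this time of the additive group, and
  \<open>\<mu>\<^sub>a\<close> is the inverse permutation of \<open>\<lambda>\<^sub>a\<close>. Hence the two actions have the same kernel and
  the same image in the symmetric group on the carrier.

  On the common kernel the two operations coincide. If one of the groups is soluble, then so is
  the kernel, as its subgroup, and so is the common image, as its homomorphic image; the other
  group is an extension of this image by the kernel and is therefore soluble too.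

  For the brace, the point is that \<open>\<mu>\<close> sends \<open>a * b\<close> to the commutator of \<open>\<mu>\<^sub>a\<^sup>-\<^sup>1\<close> and \<open>\<mu>\<^sub>b\<close>.
  So \<open>\<mu>\<close> maps the series \<open>A\<^sub>m\<close> into the derived series of its image. As the image is soluble,
  some \<open>A\<^sub>m\<close> lies in the kernel, where the operations coincide, and then
  \<open>A\<^sub>m * A\<^sub>m\<close> is trivial.
\<close>

section \<open>The action of the multiplicative group\<close>

text \<open>
  Restricting to the carrier makes \<open>\<lambda>\<^sub>a\<close> extensional, as elements of \<open>BijGroup\<close> have to be.
\<close>

definition brace_lambda ::
  "('a, 'b) monoid_scheme \<Rightarrow> ('a, 'c) monoid_scheme \<Rightarrow> 'a \<Rightarrow> 'a \<Rightarrow> 'a"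
  where "brace_lambda A M a = (\<lambda>b\<in>carrier A. inv\<^bsub>A\<^esub> a \<otimes>\<^bsub>A\<^esub> (a \<otimes>\<^bsub>M\<^esub> b))"

context skew_brace
begin

sublocale add: group A by (rule add_group)
sublocale mult: group M by (rule mult_group)

lemma mult_closed [simp]:
  "a \<in> carrier A \<Longrightarrow> b \<in> carrier A \<Longrightarrow> a \<otimes>\<^bsub>M\<^esub> b \<in> carrier A"
  using mult.m_closed carrier_eq by simp

lemma mult_inv_closed [simp]: "a \<in> carrier A \<Longrightarrow> inv\<^bsub>M\<^esub> a \<in> carrier A"
  using mult.inv_closed carrier_eq by simp

lemma mult_eq_add_lambda:
  assumes "a \<in> carrier A" "b \<in> carrier A"
  shows "a \<otimes>\<^bsub>M\<^esub> b = a \<otimes>\<^bsub>A\<^esub> brace_lambda A M a b"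
  using assms by (simp add: brace_lambda_def flip: add.m_assoc)

lemma lambda_closed [simp]:
  "a \<in> carrier A \<Longrightarrow> b \<in> carrier A \<Longrightarrow> brace_lambda A M a b \<in> carrier A"
  by (simp add: brace_lambda_def)

text \<open>
  The compatibility axiom, read through \<open>\<lambda>\<close>, says that each \<open>\<lambda>\<^sub>a\<close> preserves the additive
  operation; with associativity of the multiplication this makes \<open>\<lambda>\<close> an action.
\<close>

lemma lambda_add:
  assumes "a \<in> carrier A" "b \<in> carrier A" "c \<in> carrier A"
  shows "brace_lambda A M a (b \<otimes>\<^bsub>A\<^esub> c) = brace_lambda A M a b \<otimes>\<^bsub>A\<^esub> brace_lambda A M a c"
  using assms by (simp add: brace_lambda_def compat add.m_assoc)

lemma lambda_mult:
  assumes "a \<in> carrier A" "b \<in> carrier A" "c \<in> carrier A"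
  shows "brace_lambda A M (a \<otimes>\<^bsub>M\<^esub> b) c = brace_lambda A M a (brace_lambda A M b c)"
proof -
  have "a \<otimes>\<^bsub>A\<^esub> (brace_lambda A M a b \<otimes>\<^bsub>A\<^esub> brace_lambda A M (a \<otimes>\<^bsub>M\<^esub> b) c)
      = (a \<otimes>\<^bsub>M\<^esub> b) \<otimes>\<^bsub>A\<^esub> brace_lambda A M (a \<otimes>\<^bsub>M\<^esub> b) c"
    using assms mult_eq_add_lambda[of a b] by (simp add: add.m_assoc)
  also have "\<dots> = (a \<otimes>\<^bsub>M\<^esub> b) \<otimes>\<^bsub>M\<^esub> c"
    using assms by (simp add: mult_eq_add_lambda[of "a \<otimes>\<^bsub>M\<^esub> b" c])
  also have "\<dots> = a \<otimes>\<^bsub>M\<^esub> (b \<otimes>\<^bsub>A\<^esub> brace_lambda A M b c)"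
    using assms by (simp add: mult.m_assoc carrier_eq flip: mult_eq_add_lambda)
  also have "\<dots> = a \<otimes>\<^bsub>A\<^esub> (brace_lambda A M a b \<otimes>\<^bsub>A\<^esub> brace_lambda A M a (brace_lambda A M b c))"
    using assms by (simp add: mult_eq_add_lambda[of a] lambda_add)
  finally show ?thesis using assms by simp
qed

lemma mult_one_eq: "\<one>\<^bsub>M\<^esub> = \<one>\<^bsub>A\<^esub>"
proof -
  have o: "\<one>\<^bsub>M\<^esub> \<in> carrier A" using mult.one_closed carrier_eq by simp
  have "\<one>\<^bsub>M\<^esub> \<otimes>\<^bsub>M\<^esub> (\<one>\<^bsub>A\<^esub> \<otimes>\<^bsub>A\<^esub> \<one>\<^bsub>A\<^esub>) = \<one>\<^bsub>A\<^esub> \<otimes>\<^bsub>A\<^esub> inv\<^bsub>A\<^esub> \<one>\<^bsub>M\<^esub> \<otimes>\<^bsub>A\<^esub> \<one>\<^bsub>A\<^esub>"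
    using compat[OF o, of "\<one>\<^bsub>A\<^esub>" "\<one>\<^bsub>A\<^esub>"] carrier_eq by simp
  then have "inv\<^bsub>A\<^esub> \<one>\<^bsub>M\<^esub> = \<one>\<^bsub>A\<^esub>" using o carrier_eq by simp
  then show ?thesis using o by (metis add.inv_inv add.inv_one)
qed

lemma lambda_one:
  assumes "b \<in> carrier A"
  shows "brace_lambda A M \<one>\<^bsub>A\<^esub> b = b"
  using assms mult.l_one[of b] by (simp add: brace_lambda_def mult_one_eq carrier_eq)

lemma lambda_Bij:
  assumes "a \<in> carrier A"
  shows "brace_lambda A M a \<in> Bij (carrier A)"
proof -
  have "bij_betw (brace_lambda A M a) (carrier A) (carrier A)"
  proof (rule bij_betw_byWitness[where f' = "brace_lambda A M (inv\<^bsub>M\<^esub> a)"])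
    have "inv\<^bsub>M\<^esub> a \<otimes>\<^bsub>M\<^esub> a = \<one>\<^bsub>A\<^esub>" "a \<otimes>\<^bsub>M\<^esub> inv\<^bsub>M\<^esub> a = \<one>\<^bsub>A\<^esub>"
      using assms by (simp_all add: carrier_eq mult_one_eq)
    then show "\<forall>b\<in>carrier A. brace_lambda A M (inv\<^bsub>M\<^esub> a) (brace_lambda A M a b) = b"
      "\<forall>b\<in>carrier A. brace_lambda A M a (brace_lambda A M (inv\<^bsub>M\<^esub> a) b) = b"
      using assms by (simp_all add: lambda_one flip: lambda_mult)
  qed (use assms in auto)
  then show ?thesis by (simp add: Bij_def brace_lambda_def)
qed

lemma lambda_group_hom: "group_hom M (BijGroup (carrier A)) (brace_lambda A M)"
proof -
  have "brace_lambda A M (a \<otimes>\<^bsub>M\<^esub> b) =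
      compose (carrier A) (brace_lambda A M a) (brace_lambda A M b)"
    if "a \<in> carrier A" "b \<in> carrier A" for a b
  proof (rule extensionalityI[of _ "carrier A"])
    show "brace_lambda A M (a \<otimes>\<^bsub>M\<^esub> b) \<in> extensional (carrier A)"
      by (simp add: brace_lambda_def)
  qed (use that in \<open>simp_all add: compose_eq lambda_mult\<close>)
  then have "brace_lambda A M \<in> hom M (BijGroup (carrier A))"
    using lambda_Bij by (auto intro!: homI simp: BijGroup_def carrier_eq)
  then show ?thesis
    by (simp add: group_hom_def group_hom_axioms_def group_BijGroup mult_group)
qed

end

section \<open>The two actions of a bi-skew brace\<close>

context bi_skew_brace
begin

abbreviation "\<Lambda> \<equiv> brace_lambda A M"
abbreviation "\<mu> \<equiv> brace_lambda M A"
abbreviation "S \<equiv> BijGroup (carrier A)"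

interpretation S: group S by (rule group_BijGroup)
interpretation L: group_hom M S \<Lambda> by (rule lambda_group_hom)
interpretation U: group_hom A S \<mu>
  using opposite.lambda_group_hom by (simp add: carrier_eq)

text \<open>
  Each action rewrites one product as the other: \<open>a \<circ> b = a \<cdot> \<lambda>\<^sub>a b\<close> and \<open>a \<cdot> c = a \<circ> \<mu>\<^sub>a c\<close>.
  Taking \<open>c = \<lambda>\<^sub>a b\<close> and cancelling \<open>a\<close> gives \<open>\<mu>\<^sub>a (\<lambda>\<^sub>a b) = b\<close>.
\<close>

lemma opposite_lambda_eq_inv:
  assumes "a \<in> carrier A"
  shows "\<mu> a = inv\<^bsub>S\<^esub> (\<Lambda> a)"
proof -
  have "\<mu> a (\<Lambda> a b) = b" if "b \<in> carrier A" for b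
  proof -
    have "a \<otimes>\<^bsub>M\<^esub> \<mu> a (\<Lambda> a b) = a \<otimes>\<^bsub>M\<^esub> b"
      using assms that opposite.mult_eq_add_lambda[of a "\<Lambda> a b"]
      by (simp add: carrier_eq flip: mult_eq_add_lambda)
    then show ?thesis
      using assms that opposite.lambda_closed[of a "\<Lambda> a b"] by (simp add: carrier_eq)
  qed
  then have "compose (carrier A) (\<mu> a) (\<Lambda> a) = (\<lambda>b\<in>carrier A. b)"
    by (auto simp: compose_def)
  moreover have "\<mu> a \<in> Bij (carrier A)" "\<Lambda> a \<in> Bij (carrier A)"
    using assms lambda_Bij opposite.lambda_Bij carrier_eq by auto
  ultimately have "\<mu> a \<otimes>\<^bsub>S\<^esub> \<Lambda> a = \<one>\<^bsub>S\<^esub>" "\<mu> a \<in> carrier S" "\<Lambda> a \<in> carrier S"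
    by (simp_all add: BijGroup_def)
  then show ?thesis using S.inv_equality by simp
qed

lemma lambda_image_eq: "\<Lambda> ` carrier A = \<mu> ` carrier A"
proof -
  have "\<Lambda> a = \<mu> (inv\<^bsub>M\<^esub> a)" "\<mu> a = \<Lambda> (inv\<^bsub>M\<^esub> a)" if "a \<in> carrier A" for a
    using that L.hom_closed[of a] L.hom_inv[of a]
    by (simp_all add: opposite_lambda_eq_inv carrier_eq)
  then show ?thesis by (intro subset_antisym image_subsetI) (blast intro: image_eqI mult_inv_closed)+
qed

lemma kernel_lambda_eq: "kernel M S \<Lambda> = kernel A S \<mu>"
proof -
  have "\<Lambda> a = \<one>\<^bsub>S\<^esub> \<longleftrightarrow> \<mu> a = \<one>\<^bsub>S\<^esub>" if "a \<in> carrier A" for a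
    using that L.hom_closed[of a] by (simp add: opposite_lambda_eq_inv carrier_eq)
  then show ?thesis by (auto simp: kernel_def carrier_eq)
qed

lemma mult_eq_add_on_kernel:
  assumes "a \<in> kernel M S \<Lambda>" "b \<in> carrier A"
  shows "a \<otimes>\<^bsub>M\<^esub> b = a \<otimes>\<^bsub>A\<^esub> b"
  using assms by (simp add: kernel_def BijGroup_def carrier_eq mult_eq_add_lambda)

lemma solvable_common_image:
  assumes "solvable A"
  shows "solvable_seq S (\<mu> ` carrier A)"
  using assms U.solvable_imp_solvable_img by (simp add: solvable_def)

text \<open>
  The multiplicative group is an extension of \<open>\<lambda>(A)\<close> by the kernel of \<open>\<lambda>\<close>, and both ends are
  visible from the additive group: the image as \<open>\<mu>(A)\<close>, the kernel as a subgroup on which the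
  operations agree.
\<close>

lemma solvable_add_imp_solvable_mult:
  assumes "solvable A"
  shows "solvable M"
proof -
  define K where "K = kernel M S \<Lambda>"
  \<comment> \<open>The kernel with the additive operation is the left end of the exact sequence.\<close>
  let ?K = "A\<lparr>carrier := K\<rparr>"
  have subK: "subgroup K A"
    unfolding K_def kernel_lambda_eq by (rule U.subgroup_kernel)
  have grpK: "group ?K" using add.subgroup_imp_group[OF subK] .
  have KA: "K \<subseteq> carrier A" using subgroup.subset[OF subK] .
  have "group_hom ?K A id"
    using grpK KA by (auto simp: group_hom_def group_hom_axioms_def hom_def add_group)
  then have solK: "solvable_seq ?K K"
    using group_hom.inj_hom_imp_solvable[of ?K A id] assms by (simp add: solvable_def)
  have "group_hom ?K M id"
    using grpK KA mult_eq_add_on_kernel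
    by (auto simp: group_hom_def group_hom_axioms_def hom_def mult_group carrier_eq K_def subset_iff)
  moreover have "solvable_seq S (\<Lambda> ` carrier M)"
    using solvable_common_image[OF assms] by (simp add: carrier_eq lambda_image_eq)
  ultimately have "solvable_seq M (carrier M)"
    using solK KA
    by (intro solvable_seq_condition[OF _ lambda_group_hom, of ?K id K])
      (auto simp: K_def carrier_eq mult.subgroup_self[unfolded carrier_eq])
  then show ?thesis by (simp add: solvable_def)
qed

section \<open>The derived series of the brace\<close>

text \<open>
  Since \<open>a * b = a\<^sup>-\<^sup>1 \<cdot> (a \<circ> b) \<cdot> b\<^sup>-\<^sup>1\<close> and \<open>\<mu>\<close> turns \<open>\<cdot>\<close> into composition, only \<open>\<mu>\<close> of \<open>a \<circ> b\<close>
  needs attention: being inverse to \<open>\<lambda>\<close>, the map \<open>\<mu>\<close> reverses multiplicative products, which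
  gives \<open>\<mu>\<^sub>b \<mu>\<^sub>a\<close>. The double inverse on the right displays the result as the commutator of
  \<open>\<mu>\<^sub>a\<^sup>-\<^sup>1\<close> and \<open>\<mu>\<^sub>b\<close>, in the form in which commutators generate a derived subgroup.
\<close>

lemma opposite_lambda_star:
  assumes "a \<in> carrier A" "b \<in> carrier A"
  shows "\<mu> (brace_star A M a b) = inv\<^bsub>S\<^esub> (\<mu> a) \<otimes>\<^bsub>S\<^esub> \<mu> b \<otimes>\<^bsub>S\<^esub> inv\<^bsub>S\<^esub> (inv\<^bsub>S\<^esub> (\<mu> a)) \<otimes>\<^bsub>S\<^esub> inv\<^bsub>S\<^esub> (\<mu> b)"
proof -
  have c: "\<Lambda> a \<in> carrier S" "\<Lambda> b \<in> carrier S" "\<mu> a \<in> carrier S" "\<mu> b \<in> carrier S"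
    using assms L.hom_closed U.hom_closed carrier_eq by auto
  have "\<mu> (a \<otimes>\<^bsub>M\<^esub> b) = inv\<^bsub>S\<^esub> (\<Lambda> a \<otimes>\<^bsub>S\<^esub> \<Lambda> b)"
    using assms L.hom_mult[of a b] by (simp add: opposite_lambda_eq_inv carrier_eq)
  also have "\<dots> = \<mu> b \<otimes>\<^bsub>S\<^esub> \<mu> a"
    using assms c by (simp only: S.inv_mult_group opposite_lambda_eq_inv)
  finally have ab: "\<mu> (a \<otimes>\<^bsub>M\<^esub> b) = \<mu> b \<otimes>\<^bsub>S\<^esub> \<mu> a" .
  have "\<mu> (brace_star A M a b) = inv\<^bsub>S\<^esub> (\<mu> a) \<otimes>\<^bsub>S\<^esub> \<mu> (a \<otimes>\<^bsub>M\<^esub> b) \<otimes>\<^bsub>S\<^esub> inv\<^bsub>S\<^esub> (\<mu> b)"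
    using assms unfolding brace_star_def
    by (simp only: U.hom_mult U.hom_inv add.inv_closed add.m_closed mult_closed)
  also have "\<dots> = inv\<^bsub>S\<^esub> (\<mu> a) \<otimes>\<^bsub>S\<^esub> \<mu> b \<otimes>\<^bsub>S\<^esub> inv\<^bsub>S\<^esub> (inv\<^bsub>S\<^esub> (\<mu> a)) \<otimes>\<^bsub>S\<^esub> inv\<^bsub>S\<^esub> (\<mu> b)"
    using c by (simp only: ab S.m_assoc S.m_closed S.inv_closed S.inv_inv)
  finally show ?thesis .
qed

lemma brace_star_closed:
  "a \<in> carrier A \<Longrightarrow> b \<in> carrier A \<Longrightarrow> brace_star A M a b \<in> carrier A"
  by (simp add: brace_star_def)

lemma opposite_lambda_star_set:
  assumes X: "X \<subseteq> carrier A" and H: "subgroup H S" and XH: "\<mu> ` X \<subseteq> H"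
  shows "\<mu> ` brace_star_set A M X X \<subseteq> derived S H"
proof -
  let ?G = "{brace_star A M x y | x y. x \<in> X \<and> y \<in> X}"
  have G: "?G \<subseteq> carrier A" using X brace_star_closed by auto
  have "\<mu> ` ?G \<subseteq> derived_set S H"
  proof clarify
    fix x y assume xy: "x \<in> X" "y \<in> X"
    then have "inv\<^bsub>S\<^esub> (\<mu> x) \<in> H" "\<mu> y \<in> H"
      using XH subgroup.m_inv_closed[OF H] by auto
    then show "\<mu> (brace_star A M x y) \<in> derived_set S H"
      using xy X by (subst opposite_lambda_star) blast+
  qed
  then have "generate S (\<mu> ` ?G) \<subseteq> derived S H"
    unfolding derived_def by (rule S.mono_generate)
  then show ?thesis
    by (simp only: U.generate_img[OF G] brace_star_set_def)
qed

lemma opposite_lambda_derived_series: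
  "brace_derived_series A M (Suc k) \<subseteq> carrier A \<and>
   \<mu> ` brace_derived_series A M (Suc k) \<subseteq> (derived S ^^ k) (\<mu> ` carrier A)"
proof (induction k)
  case 0
  show ?case by (simp add: brace_derived_series_def)
next
  case (Suc k)
  let ?X = "brace_derived_series A M (Suc k)"
  have step: "brace_derived_series A M (Suc (Suc k)) = brace_star_set A M ?X ?X"
    by (simp add: brace_derived_series_def)
  have "subgroup ((derived S ^^ k) (\<mu> ` carrier A)) S"
    by (intro S.exp_of_derived_is_subgroup U.subgroup_img_is_subgroup add.subgroup_self)
  moreover have "brace_star_set A M ?X ?X \<subseteq> carrier A"
    unfolding brace_star_set_def using Suc brace_star_closed
    by (intro add.generate_incl) blast
  ultimately show ?case
    using Suc opposite_lambda_star_set[of ?X] step by simp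
qed

lemma solvable_add_imp_soluble_brace:
  assumes "solvable A"
  shows "soluble_brace A M"
proof -
  obtain n where n: "(derived S ^^ n) (\<mu> ` carrier A) = {\<one>\<^bsub>S\<^esub>}"
    using S.solvable_imp_trivial_derived_seq[OF solvable_common_image[OF assms]] by blast
  \<comment> \<open>This term lies in the kernel, so its star product with itself vanishes.\<close>
  let ?X = "brace_derived_series A M (Suc n)"
  have XA: "?X \<subseteq> carrier A" and XK: "?X \<subseteq> kernel M S \<Lambda>"
    unfolding kernel_lambda_eq using opposite_lambda_derived_series[of n] n
    by (auto simp: kernel_def)
  have "brace_star A M x y = \<one>\<^bsub>A\<^esub>" if "x \<in> ?X" "y \<in> ?X" for x y
  proof -
    have "x \<in> carrier A" "y \<in> carrier A" "x \<otimes>\<^bsub>M\<^esub> y = x \<otimes>\<^bsub>A\<^esub> y"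
      using that XA XK mult_eq_add_on_kernel by blast+
    then show ?thesis by (simp add: brace_star_def flip: add.m_assoc)
  qed
  then have "brace_star_set A M ?X ?X \<subseteq> {\<one>\<^bsub>A\<^esub>}"
    unfolding brace_star_set_def
    by (intro add.generate_subgroup_incl add.triv_subgroup) auto
  then have "brace_star_set A M ?X ?X = {\<one>\<^bsub>A\<^esub>}"
    unfolding brace_star_set_def using generate.one by blast
  then have "brace_derived_series A M (Suc (Suc n)) = {\<one>\<^bsub>A\<^esub>}"
    by (simp add: brace_derived_series_def)
  then show ?thesis
    unfolding soluble_brace_def by (intro exI[of _ "Suc (Suc n)"]) simp
qed

end

section \<open>Solubility of bi-skew braces\<close>

theorem theorem3p11:
  fixes A :: "('a, 'b) monoid_scheme" and M :: "('a, 'c) monoid_scheme"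
  assumes "bi_skew_brace A M"
  shows "(solvable A \<longleftrightarrow> solvable M) \<and> (solvable A \<longrightarrow> soluble_brace A M)"
proof -
  interpret AM: bi_skew_brace A M by (rule assms)
  have MA: "bi_skew_brace M A"
    by (intro bi_skew_brace.intro AM.opposite.skew_brace_axioms AM.skew_brace_axioms)
  show ?thesis
    using AM.solvable_add_imp_solvable_mult AM.solvable_add_imp_soluble_brace
      bi_skew_brace.solvable_add_imp_solvable_mult[OF MA] by blast
qed

end
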